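(* Let $k$ be a positive integer. In the free group on $x, y$ define $s_1 = x$ and $s_{m+1} = [s_m, y]$ for positive integers $m$. Then the one-relator group $G = \langle x, y ; r = [s_k, y] \rangle$, with generators $x, y$ and single defining relator $r = [s_k, y]$, is free-by-cyclic, and therefore residually solvable.
   Context: Commutators are $[u,v] = u^{-1}v^{-1}uv$. A group $G$ is free-by-cyclic if it has a normal subgroup $N$ that is a free group and such that $G/N$ is cyclic. A group $G$ is residually solvable if for each $g \in G$ with $g \neq 1$ there exist a solvable group $S_g$ and an epimorphism $\phi : G \to S_g$ such that $\phi(g) \neq 1$. The notation $\langle X ; r \rangle$ denotes the group presented by generators $X$ and the defining relation $r = 1$. *)

theory Defs
  imports "HOL-Algebra.Elementary_Groups" "HOL-Algebra.Solvable_Groups"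
begin

section \<open>Free groups\<close>

text \<open>Elements of the free group on \<open>X\<close> are the freely reduced words in the letters
  \<open>(x, True)\<close>, standing for the generator \<open>x\<close>, and \<open>(x, False)\<close>, standing for its inverse.\<close>

type_synonym 'a fg_word = "('a \<times> bool) list"

definition inv_letter :: "'a \<times> bool \<Rightarrow> 'a \<times> bool" where
  "inv_letter a = (fst a, \<not> snd a)"

definition reduced :: "'a fg_word \<Rightarrow> bool" where
  "reduced w \<longleftrightarrow> successively (\<lambda>a b. b \<noteq> inv_letter a) w"

fun cancel_cons :: "'a \<times> bool \<Rightarrow> 'a fg_word \<Rightarrow> 'a fg_word" where
  "cancel_cons a [] = [a]"
| "cancel_cons a (b # w) = (if b = inv_letter a then w else a # b # w)"

definition reduce :: "'a fg_word \<Rightarrow> 'a fg_word" where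
  "reduce w = foldr cancel_cons w []"

definition free_group :: "'a set \<Rightarrow> 'a fg_word monoid" where
  "free_group X =
     \<lparr>carrier = {w. reduced w \<and> fst ` set w \<subseteq> X},
      monoid.mult = (\<lambda>u v. reduce (u @ v)),
      one = []\<rparr>"

definition fg_gen :: "'a \<Rightarrow> 'a fg_word" where
  "fg_gen x = [(x, True)]"

text \<open>Any free generating set of \<open>G\<close> embeds into \<open>G\<close>, so it is no restriction that the index set
  \<open>X\<close> has elements of the same type as \<open>G\<close>.\<close>

definition is_free_group :: "('a, 'b) monoid_scheme \<Rightarrow> bool" where
  "is_free_group G \<longleftrightarrow> group G \<and> (\<exists>X :: 'a set. free_group X \<cong> G)"

section \<open>Presentations\<close>

definition normal_closure :: "('a, 'b) monoid_scheme \<Rightarrow> 'a set \<Rightarrow> 'a set" where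
  "normal_closure G R = \<Inter> {N. N \<lhd> G \<and> R \<subseteq> N}"

definition presented_group :: "'a set \<Rightarrow> 'a fg_word set \<Rightarrow> 'a fg_word set monoid" where
  "presented_group X R = free_group X Mod normal_closure (free_group X) R"

text \<open>The convention is \<open>[u, v] = u\<^sup>-\<^sup>1 v\<^sup>-\<^sup>1 u v\<close>, unlike the one underlying
  \<^const>\<open>derived\<close>.\<close>

definition commutator :: "('a, 'b) monoid_scheme \<Rightarrow> 'a \<Rightarrow> 'a \<Rightarrow> 'a" where
  "commutator G u v = inv\<^bsub>G\<^esub> u \<otimes>\<^bsub>G\<^esub> inv\<^bsub>G\<^esub> v \<otimes>\<^bsub>G\<^esub> u \<otimes>\<^bsub>G\<^esub> v"

section \<open>Free-by-cyclic and residually solvable groups\<close>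

definition free_by_cyclic :: "('a, 'b) monoid_scheme \<Rightarrow> bool" where
  "free_by_cyclic G \<longleftrightarrow>
     group G \<and> (\<exists>N. N \<lhd> G \<and> is_free_group (G\<lparr>carrier := N\<rparr>) \<and> cyclic_group (G Mod N))"

text \<open>Every epimorphic image of \<open>G\<close> is isomorphic to some \<open>G Mod N\<close>, so it is no restriction that
  the solvable groups \<open>S\<close> have elements of type \<^typ>\<open>'a set\<close>.\<close>

definition residually_solvable :: "('a, 'b) monoid_scheme \<Rightarrow> bool" where
  "residually_solvable G \<longleftrightarrow>
     group G \<and>
     (\<forall>g \<in> carrier G. g \<noteq> \<one>\<^bsub>G\<^esub> \<longrightarrow>
        (\<exists>(S :: 'a set monoid) \<phi>. group S \<and> solvable S \<and> \<phi> \<in> epi G S \<and> \<phi> g \<noteq> \<one>\<^bsub>S\<^esub>))"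

section \<open>The free group is a group\<close>

lemma inv_letter_invol [simp]: "inv_letter (inv_letter a) = a"
  by (simp add: inv_letter_def)

lemma fst_inv_letter [simp]: "fst (inv_letter a) = fst a"
  by (simp add: inv_letter_def)

lemma reduced_cancel_cons: "reduced w \<Longrightarrow> reduced (cancel_cons a w)"
  by (cases w) (auto simp: reduced_def successively_Cons)

lemma cancel_cons_inv: "reduced w \<Longrightarrow> cancel_cons a (cancel_cons (inv_letter a) w) = w"
  by (cases w rule: remdups_adj.cases) (auto simp: reduced_def)

lemma cancel_cons_inv': "reduced w \<Longrightarrow> cancel_cons (inv_letter a) (cancel_cons a w) = w"
  using cancel_cons_inv[of w "inv_letter a"] by simp

lemma reduced_foldr: "reduced w \<Longrightarrow> reduced (foldr cancel_cons u w)"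
  by (induction u) (auto intro: reduced_cancel_cons)

lemma reduced_reduce: "reduced (reduce w)"
  unfolding reduce_def by (rule reduced_foldr) (simp add: reduced_def)

lemma reduce_reduced: "reduced w \<Longrightarrow> reduce w = w"
proof (induction w)
  case (Cons a w)
  then have "reduced w" by (auto simp: reduced_def successively_Cons)
  with Cons show ?case by (cases w) (auto simp: reduce_def reduced_def)
qed (simp add: reduce_def)

lemma foldr_cancel_cons:
  "reduced w \<Longrightarrow> foldr cancel_cons (cancel_cons a u) w = cancel_cons a (foldr cancel_cons u w)"
  by (cases u) (auto simp: cancel_cons_inv reduced_foldr)

lemma foldr_reduce: "reduced w \<Longrightarrow> foldr cancel_cons (reduce u) w = foldr cancel_cons u w"
  by (induction u) (auto simp: reduce_def foldr_cancel_cons)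

lemma reduce_append: "reduce (u @ v) = foldr cancel_cons u (reduce v)"
  by (simp add: reduce_def)

lemma set_cancel_cons: "set (cancel_cons a w) \<subseteq> insert a (set w)"
  by (cases w) auto

lemma set_reduce: "set (reduce w) \<subseteq> set w"
proof (induction w)
  case (Cons a w)
  then show ?case using set_cancel_cons[of a "reduce w"] by (auto simp: reduce_def)
qed (simp add: reduce_def)

lemma reduced_inv: "reduced w \<Longrightarrow> reduced (rev (map inv_letter w))"
  unfolding reduced_def successively_rev successively_map
  by (erule successively_mono) (metis inv_letter_invol)

lemma reduce_inv: "reduce (rev (map inv_letter w) @ w) = []"
proof -
  have "foldr cancel_cons (rev (map inv_letter w)) (foldr cancel_cons w v) = v"
    if "reduced v" for v
    using that by (induction w) (auto simp: cancel_cons_inv' reduced_foldr)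
  from this[of "[]"] show ?thesis
    by (simp add: reduce_def reduced_def)
qed

lemma group_free_group: "group (free_group (X :: 'a set))"
proof (rule groupI)
  fix u v assume "u \<in> carrier (free_group X)" "v \<in> carrier (free_group X)"
  then show "u \<otimes>\<^bsub>free_group X\<^esub> v \<in> carrier (free_group X)"
    using set_reduce[of "u @ v"] by (fastforce simp: free_group_def reduced_reduce)
next
  fix u v w :: "'a fg_word"
  have "reduce (reduce (u @ v) @ w) = foldr cancel_cons (u @ v) (reduce w)"
    by (simp only: reduce_append[of "reduce (u @ v)"] foldr_reduce[OF reduced_reduce])
  also have "\<dots> = reduce (u @ reduce (v @ w))"
    by (simp add: reduce_append reduce_reduced reduced_foldr reduced_reduce)
  finally show "u \<otimes>\<^bsub>free_group X\<^esub> v \<otimes>\<^bsub>free_group X\<^esub> w =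
      u \<otimes>\<^bsub>free_group X\<^esub> (v \<otimes>\<^bsub>free_group X\<^esub> w)"
    by (simp add: free_group_def)
next
  fix u assume "u \<in> carrier (free_group X)"
  then show "\<exists>v\<in>carrier (free_group X). v \<otimes>\<^bsub>free_group X\<^esub> u = \<one>\<^bsub>free_group X\<^esub>"
    by (intro bexI[of _ "rev (map inv_letter u)"])
       (auto simp: free_group_def reduce_inv reduced_inv image_image)
qed (auto simp: free_group_def reduce_reduced, auto simp: reduced_def)

lemma fg_gen_in_carrier: "x \<in> X \<Longrightarrow> fg_gen x \<in> carrier (free_group X)"
  by (simp add: fg_gen_def free_group_def reduced_def)

lemma (in group) normal_normal_closure:
  assumes "R \<subseteq> carrier G"
  shows "normal_closure G R \<lhd> G"
proof -
  have G: "carrier G \<lhd> G"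
    by (simp add: normal_inv_iff subgroup_self)
  have "subgroup (normal_closure G R) G"
    unfolding normal_closure_def
    by (rule subgroups_Inter) (use G assms in \<open>auto intro: normal_imp_subgroup\<close>)
  then show ?thesis
    by (auto simp: normal_inv_iff normal_closure_def)
qed

lemma group_presented_group:
  assumes "R \<subseteq> carrier (free_group X)"
  shows "group (presented_group X R)"
  unfolding presented_group_def
  by (intro normal.factorgroup_is_group group.normal_normal_closure group_free_group assms)

end

theory Submission
  imports Defs "HOL-Algebra.Bij"
begin

text \<open>
  Modulo the relator, conjugation by \<open>y\<close> sends \<open>s\<^sub>m\<close> to \<open>s\<^sub>m s\<^sub>m\<^sub>+\<^sub>1\<close> for \<open>1 \<le> m \<le> k\<close>, where
  \<open>s\<^sub>k\<^sub>+\<^sub>1 = r\<close> is trivial. So the subgroup \<open>N\<close> generated by \<open>s\<^sub>1, \<dots>, s\<^sub>k\<close> contains \<open>x = s\<^sub>1\<close>, is normal,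
  and has a cyclic quotient, generated by the image of \<open>y\<close>
  (\<open>commutator_tower_normal_cyclic\<close>).

  It remains to see that \<open>s\<^sub>1, \<dots>, s\<^sub>k\<close> generate \<open>N\<close> freely. Let \<open>F\<close> be free on \<open>t\<^sub>1, \<dots>, t\<^sub>k\<close>, put
  \<open>t\<^sub>m = 1\<close> for \<open>m > k\<close>, and let \<open>\<psi>\<close> be the inverse of the automorphism \<open>t\<^sub>m \<mapsto> t\<^sub>m t\<^sub>m\<^sub>+\<^sub>1\<close> of \<open>F\<close>
  (\<open>tower_automorphism\<close>). Let \<open>x\<close> act on the set \<open>F\<close> as left multiplication by \<open>t\<^sub>1\<close>, and \<open>y\<close>
  as \<open>\<psi>\<close>. Then each \<open>s\<^sub>m\<close> acts as left multiplication by \<open>t\<^sub>m\<close> (\<open>tower_model\<close>); in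
  particular \<open>r\<close> acts trivially, so the one-relator group acts on \<open>F\<close>. Composing \<open>F \<rightarrow> N\<close>,
  \<open>t\<^sub>m \<mapsto> s\<^sub>m\<close>, with this action yields the faithful action of \<open>F\<close> on itself, hence \<open>F \<rightarrow> N\<close> is
  injective. (Abstractly, the group is the semidirect product of \<open>F\<close> with an infinite cyclic
  group.)

  Every free-by-cyclic group \<open>G\<close> is residually solvable
  (\<open>free_by_cyclic_imp_residually_solvable\<close>): a cyclic quotient is abelian, so the derived series
  of \<open>G\<close> is, one step delayed, contained in that of the free group \<open>N\<close>. The latter has trivial
  intersection, because the shortest nontrivial words in its successive terms get longer and
  longer (\<open>length_less_of_derived_series\<close>).
\<close>

section \<open>The universal property of free groups\<close>

definition letter_value :: "('b, 'c) monoid_scheme \<Rightarrow> ('a \<Rightarrow> 'b) \<Rightarrow> 'a \<times> bool \<Rightarrow> 'b" where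
  "letter_value H f a = (if snd a then f (fst a) else inv\<^bsub>H\<^esub> f (fst a))"

definition free_lift :: "('b, 'c) monoid_scheme \<Rightarrow> ('a \<Rightarrow> 'b) \<Rightarrow> 'a fg_word \<Rightarrow> 'b" where
  "free_lift H f w = foldr (\<lambda>a g. letter_value H f a \<otimes>\<^bsub>H\<^esub> g) w \<one>\<^bsub>H\<^esub>"

lemma free_group_one [simp]: "\<one>\<^bsub>free_group X\<^esub> = []"
  by (simp add: free_group_def)

lemma free_group_mult: "u \<otimes>\<^bsub>free_group X\<^esub> v = reduce (u @ v)"
  by (simp add: free_group_def)

lemma free_group_carrier: "w \<in> carrier (free_group X) \<longleftrightarrow> reduced w \<and> fst ` set w \<subseteq> X"
  by (simp add: free_group_def)

lemma reduce_append_left: "reduce (reduce u @ v) = reduce (u @ v)"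
  by (simp add: reduce_append foldr_reduce reduced_reduce)

lemma reduce_append_right: "reduce (u @ reduce v) = reduce (u @ v)"
  by (simp add: reduce_append reduce_reduced reduced_reduce)

lemma reduced_ConsD: "reduced (a # w) \<Longrightarrow> reduced w"
  by (auto simp: reduced_def successively_Cons)

lemma free_lift_simps [simp]:
  "free_lift H f [] = \<one>\<^bsub>H\<^esub>"
  "free_lift H f (a # w) = letter_value H f a \<otimes>\<^bsub>H\<^esub> free_lift H f w"
  by (simp_all add: free_lift_def)

context group
begin

lemma letter_value_closed:
  assumes "f \<in> X \<rightarrow> carrier G" "fst a \<in> X"
  shows "letter_value G f a \<in> carrier G"
  using assms by (auto simp: letter_value_def)

lemma letter_value_inv_letter:
  assumes "f \<in> X \<rightarrow> carrier G" "fst a \<in> X"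
  shows "letter_value G f a \<otimes> letter_value G f (inv_letter a) = \<one>"
proof -
  have "f (fst a) \<in> carrier G"
    using assms by auto
  then show ?thesis
    by (auto simp: letter_value_def inv_letter_def)
qed

lemma free_lift_closed:
  assumes "f \<in> X \<rightarrow> carrier G" "fst ` set w \<subseteq> X"
  shows "free_lift G f w \<in> carrier G"
  using assms(2) by (induction w) (auto intro: letter_value_closed[OF assms(1)])

lemma free_lift_append:
  assumes f: "f \<in> X \<rightarrow> carrier G" and "fst ` set u \<subseteq> X" and v: "fst ` set v \<subseteq> X"
  shows "free_lift G f (u @ v) = free_lift G f u \<otimes> free_lift G f v"
  using assms(2)
proof (induction u)
  case (Cons a u)
  then show ?case
    using letter_value_closed[OF f, of a] free_lift_closed[OF f, of u] free_lift_closed[OF f v]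
    by (simp add: m_assoc)
qed (simp add: free_lift_closed[OF f v])

lemma free_lift_cancel_cons:
  assumes f: "f \<in> X \<rightarrow> carrier G" and a: "fst a \<in> X" and w: "fst ` set w \<subseteq> X"
  shows "free_lift G f (cancel_cons a w) = letter_value G f a \<otimes> free_lift G f w"
proof (cases w)
  case (Cons b v)
  have "letter_value G f a \<in> carrier G" "letter_value G f (inv_letter a) \<in> carrier G"
    "free_lift G f v \<in> carrier G"
    using letter_value_closed[OF f] free_lift_closed[OF f] a w Cons by auto
  then have "letter_value G f a \<otimes> (letter_value G f (inv_letter a) \<otimes> free_lift G f v) =
      free_lift G f v"
    by (simp add: letter_value_inv_letter[OF f a] flip: m_assoc)
  then show ?thesis
    using Cons by simp
qed simp

lemma free_lift_reduce:
  assumes f: "f \<in> X \<rightarrow> carrier G" and "fst ` set w \<subseteq> X"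
  shows "free_lift G f (reduce w) = free_lift G f w"
  using assms(2)
proof (induction w)
  case (Cons a w)
  have "fst ` set (reduce w) \<subseteq> X"
    using Cons.prems set_reduce[of w] by auto
  moreover have "reduce (a # w) = cancel_cons a (reduce w)"
    by (simp add: reduce_def)
  ultimately show ?case
    using Cons free_lift_cancel_cons[OF f, of a "reduce w"] by auto
qed (simp add: reduce_def)

lemma free_lift_hom:
  assumes f: "f \<in> X \<rightarrow> carrier G"
  shows "free_lift G f \<in> hom (free_group X) G"
proof (rule homI)
  fix u v assume "u \<in> carrier (free_group X)" "v \<in> carrier (free_group X)"
  then show "free_lift G f (u \<otimes>\<^bsub>free_group X\<^esub> v) = free_lift G f u \<otimes> free_lift G f v"
    using free_lift_reduce[OF f, of "u @ v"] free_lift_append[OF f, of u v]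
    by (auto simp: free_group_carrier free_group_mult image_Un)
qed (auto simp: free_group_carrier intro: free_lift_closed[OF f])

lemma free_lift_gen:
  assumes "f \<in> X \<rightarrow> carrier G" "x \<in> X"
  shows "free_lift G f (fg_gen x) = f x"
  using funcset_mem[OF assms] by (simp add: fg_gen_def letter_value_def)

end

text \<open>Peeling off the first letter of a reduced word leaves a reduced word, so a reduced word is the
  product in the free group of its letters.\<close>
lemma free_group_generated: "generate (free_group X) (fg_gen ` X) = carrier (free_group X)"
proof -
  interpret F: group "free_group X" by (rule group_free_group)
  have "w \<in> generate (free_group X) (fg_gen ` X)" if "w \<in> carrier (free_group X)" for w
    using that
  proof (induction w)
    case Nil
    then show ?case
      using generate.one[of "free_group X"] by simp
  next
    case (Cons a w)
    have a: "fst a \<in> X" and red: "reduced (a # w)"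
      using Cons.prems by (auto simp: free_group_carrier)
    have w: "w \<in> carrier (free_group X)"
      using Cons.prems reduced_ConsD[OF red] by (auto simp: free_group_carrier)
    have "[a] \<in> generate (free_group X) (fg_gen ` X)"
    proof (cases "snd a")
      case True
      then have "[a] = fg_gen (fst a)"
        by (cases a) (simp add: fg_gen_def)
      then show ?thesis
        using a by (auto intro: generate.incl)
    next
      case False
      then have "[a] \<otimes>\<^bsub>free_group X\<^esub> fg_gen (fst a) = \<one>\<^bsub>free_group X\<^esub>"
        by (cases a) (simp add: free_group_mult fg_gen_def reduce_def inv_letter_def)
      moreover have "[a] \<in> carrier (free_group X)"
        using a by (simp add: free_group_carrier reduced_def)
      ultimately have "inv\<^bsub>free_group X\<^esub> fg_gen (fst a) = [a]"
        by (intro F.inv_equality fg_gen_in_carrier a)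
      then show ?thesis
        using a generate.inv[of "fg_gen (fst a)" "fg_gen ` X" "free_group X"] by auto
    qed
    then have "[a] \<otimes>\<^bsub>free_group X\<^esub> w \<in> generate (free_group X) (fg_gen ` X)"
      using Cons.IH[OF w] by (rule generate.eng)
    then show ?case
      by (simp add: free_group_mult reduce_reduced[OF red])
  qed
  moreover have "generate (free_group X) (fg_gen ` X) \<subseteq> carrier (free_group X)"
    by (rule F.generate_incl) (auto intro: fg_gen_in_carrier)
  ultimately show ?thesis
    by blast
qed

lemma hom_eq_on_generate:
  assumes "group G" "group H" "g \<in> hom G H" "h \<in> hom G H" "A \<subseteq> carrier G"
    and eq: "\<And>a. a \<in> A \<Longrightarrow> g a = h a" and "w \<in> generate G A"
  shows "g w = h w"
proof -
  interpret g: group_hom G H g using assms by (simp add: group_hom_def group_hom_axioms_def)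
  interpret h: group_hom G H h using assms by (simp add: group_hom_def group_hom_axioms_def)
  show ?thesis
    using \<open>w \<in> generate G A\<close>
  proof (induction rule: generate.induct)
    case (eng u v)
    then show ?case
      using g.G.generate_in_carrier[OF \<open>A \<subseteq> carrier G\<close>] by simp
  qed (use \<open>A \<subseteq> carrier G\<close> in \<open>auto simp: eq\<close>)
qed

lemma free_group_hom_eq:
  assumes "group H" "g \<in> hom (free_group X) H" "h \<in> hom (free_group X) H"
    and "\<And>x. x \<in> X \<Longrightarrow> g (fg_gen x) = h (fg_gen x)" and "w \<in> carrier (free_group X)"
  shows "g w = h w"
  by (rule hom_eq_on_generate[OF group_free_group assms(1-3), of "fg_gen ` X"])
     (use assms(4,5) in \<open>auto simp: free_group_generated intro: fg_gen_in_carrier\<close>)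

lemma free_group_endo_id:
  assumes "h \<in> hom (free_group X) (free_group X)" "\<And>x. x \<in> X \<Longrightarrow> h (fg_gen x) = fg_gen x"
    and "w \<in> carrier (free_group X)"
  shows "h w = w"
  using free_group_hom_eq[OF group_free_group assms(1), of "\<lambda>w. w" w] assms(2,3)
  by (simp add: hom_def)

text \<open>The lifts of the two substitutions of generators are mutually inverse, as their composites fix
  every generator.\<close>
lemma free_group_relabel:
  fixes f :: "'a \<Rightarrow> 'b"
  assumes "inj_on f I"
  shows "free_group (f ` I) \<cong> free_group I"
proof -
  interpret I: group "free_group I" by (rule group_free_group)
  interpret J: group "free_group (f ` I)" by (rule group_free_group)
  define \<sigma> where "\<sigma> = free_lift (free_group (f ` I)) (\<lambda>i. fg_gen (f i))"
  define \<rho> where "\<rho> = free_lift (free_group I) (\<lambda>j. fg_gen (inv_into I f j))"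
  have s: "(\<lambda>i. fg_gen (f i)) \<in> I \<rightarrow> carrier (free_group (f ` I))"
    by (auto intro: fg_gen_in_carrier)
  have r: "(\<lambda>j. fg_gen (inv_into I f j)) \<in> f ` I \<rightarrow> carrier (free_group I)"
    using assms by (auto intro: fg_gen_in_carrier)
  have hom: "\<sigma> \<in> hom (free_group I) (free_group (f ` I))" "\<rho> \<in> hom (free_group (f ` I)) (free_group I)"
    unfolding \<sigma>_def \<rho>_def by (intro J.free_lift_hom I.free_lift_hom r s)+
  have "\<rho> (\<sigma> w) = w" if "w \<in> carrier (free_group I)" for w
  proof (rule free_group_endo_id[of "\<lambda>w. \<rho> (\<sigma> w)", OF _ _ that])
    show "(\<lambda>w. \<rho> (\<sigma> w)) \<in> hom (free_group I) (free_group I)"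
      using hom_compose[OF hom] by (simp add: o_def)
    show "\<rho> (\<sigma> (fg_gen i)) = fg_gen i" if "i \<in> I" for i
      using that assms J.free_lift_gen[OF s] I.free_lift_gen[OF r] by (simp add: \<sigma>_def \<rho>_def)
  qed
  moreover have "\<sigma> (\<rho> w) = w" if "w \<in> carrier (free_group (f ` I))" for w
  proof (rule free_group_endo_id[of "\<lambda>w. \<sigma> (\<rho> w)", OF _ _ that])
    show "(\<lambda>w. \<sigma> (\<rho> w)) \<in> hom (free_group (f ` I)) (free_group (f ` I))"
      using hom_compose[OF hom(2,1)] by (simp add: o_def)
    show "\<sigma> (\<rho> (fg_gen j)) = fg_gen j" if "j \<in> f ` I" for j
      using that assms J.free_lift_gen[OF s] I.free_lift_gen[OF r] by (auto simp: \<sigma>_def \<rho>_def)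
  qed
  ultimately have "group_isomorphisms (free_group (f ` I)) (free_group I) \<rho> \<sigma>"
    using hom by (simp add: group_isomorphisms_def)
  then show ?thesis
    unfolding is_iso_def using group_isomorphisms_imp_iso by blast
qed

text \<open>The definition of a free group asks for a free generating set among the elements of the group
  itself; the images of the generators serve, after relabelling each by its image.\<close>
lemma is_free_group_hom_image:
  assumes "group G" and h: "h \<in> hom (free_group I) G" and inj: "inj_on h (carrier (free_group I))"
  shows "is_free_group (G\<lparr>carrier := h ` carrier (free_group I)\<rparr>)"
proof -
  interpret group_hom "free_group I" G h
    using assms group_free_group by (simp add: group_hom_def group_hom_axioms_def)
  let ?N = "G\<lparr>carrier := h ` carrier (free_group I)\<rparr>"
  have "h \<in> iso (free_group I) ?N"
    using inj h by (auto simp: iso_def hom_def bij_betw_def)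
  then have "free_group I \<cong> ?N"
    by (auto simp: is_iso_def)
  moreover have "inj_on (\<lambda>i. h (fg_gen i)) I"
  proof (rule inj_onI)
    fix i j assume "i \<in> I" "j \<in> I" "h (fg_gen i) = h (fg_gen j)"
    then have "fg_gen i = fg_gen j"
      using inj by (auto dest: inj_onD intro: fg_gen_in_carrier)
    then show "i = j"
      by (simp add: fg_gen_def)
  qed
  then have "free_group ((\<lambda>i. h (fg_gen i)) ` I) \<cong> free_group I"
    by (rule free_group_relabel)
  ultimately have "free_group ((\<lambda>i. h (fg_gen i)) ` I) \<cong> ?N"
    using iso_trans by blast
  moreover have "group ?N"
    using img_is_subgroup by (rule H.subgroup_imp_group)
  ultimately show ?thesis
    unfolding is_free_group_def by blast
qed

section \<open>The derived series of a free group\<close>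

text \<open>A word \<open>w\<close> spells a path in the Schreier graph of \<open>N\<close>, the graph on the cosets of \<open>N\<close> in
  which the letter \<open>b\<close> leads from \<open>N u\<close> to \<open>N u b\<close>. This is the number of times that the path
  starting at \<open>N u\<close> passes along the edge that leaves the vertex \<open>N\<close> with letter \<open>a\<close>, where
  passing against the direction of that edge counts negatively.\<close>
fun letter_flow :: "'a fg_word set \<Rightarrow> 'a \<times> bool \<Rightarrow> 'a fg_word \<Rightarrow> 'a fg_word \<Rightarrow> int" where
  "letter_flow N a u [] = 0"
| "letter_flow N a u (b # w) =
     of_bool (b = a \<and> reduce u \<in> N) - of_bool (b = inv_letter a \<and> reduce (u @ [b]) \<in> N)
       + letter_flow N a (u @ [b]) w"

lemma inv_letter_neq [simp]: "inv_letter a \<noteq> a" "a \<noteq> inv_letter a"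
  by (auto simp: inv_letter_def prod_eq_iff)

lemma letter_flow_append:
  "letter_flow N a u (v @ w) = letter_flow N a u v + letter_flow N a (u @ v) w"
  by (induction v arbitrary: u) auto

text \<open>The starting point matters only up to its coset of \<open>N\<close>; for the flow, a vertex is known by the
  words that lead from it to \<open>N\<close>.\<close>
lemma letter_flow_cong:
  assumes "\<And>v. reduce (u @ v) \<in> N \<longleftrightarrow> reduce (u' @ v) \<in> N"
  shows "letter_flow N a u w = letter_flow N a u' w"
  using assms
proof (induction w arbitrary: u u')
  case (Cons b w)
  have "letter_flow N a (u @ [b]) w = letter_flow N a (u' @ [b]) w"
    by (rule Cons.IH) (use Cons.prems in simp)
  then show ?case
    using Cons.prems[of "[]"] Cons.prems[of "[b]"] by simp
qed simp

lemma reduce_cancel_pair: "reduce (u @ b # inv_letter b # v) = reduce (u @ v)"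
proof -
  have "reduce (b # inv_letter b # v) = cancel_cons b (cancel_cons (inv_letter b) (reduce v))"
    by (simp add: reduce_def)
  also have "\<dots> = reduce v"
    by (rule cancel_cons_inv[OF reduced_reduce])
  finally show ?thesis
    by (metis reduce_append_right)
qed

text \<open>A backtracking \<open>b b\<^sup>-\<^sup>1\<close> runs along one edge in both directions and contributes nothing.\<close>
lemma letter_flow_cancel_cons: "letter_flow N a u (cancel_cons b w) = letter_flow N a u (b # w)"
proof (cases w)
  case (Cons c v)
  have "letter_flow N a (u @ [b, inv_letter b]) v = letter_flow N a u v"
    by (rule letter_flow_cong) (simp add: reduce_cancel_pair)
  moreover have "reduce (u @ [b, inv_letter b]) = reduce u"
    using reduce_cancel_pair[of u b "[]"] by simp
  moreover have "inv_letter b = a \<longleftrightarrow> b = inv_letter a" "inv_letter b = inv_letter a \<longleftrightarrow> b = a"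
    by (metis inv_letter_invol)+
  ultimately show ?thesis
    using Cons by simp
qed simp

lemma letter_flow_reduce: "letter_flow N a u (reduce w) = letter_flow N a u w"
proof (induction w arbitrary: u)
  case (Cons b w)
  have "reduce (b # w) = cancel_cons b (reduce w)"
    by (simp add: reduce_def)
  then show ?case
    using Cons by (simp only: letter_flow_cancel_cons letter_flow.simps)
qed (simp add: reduce_def)

text \<open>Elements of \<open>N\<close> are closed paths at the vertex \<open>N\<close>, and concatenation adds flows. Thus the
  flow is a homomorphism from \<open>N\<close> to the integers, and it kills commutators.\<close>
lemma letter_flow_derived:
  assumes "subgroup N (free_group X)" and "w \<in> derived (free_group X) N"
  shows "letter_flow N a [] w = 0"
proof -
  interpret F: group "free_group X" by (rule group_free_group)
  interpret N: subgroup N "free_group X" by (rule assms(1))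
  let ?N = "free_group X\<lparr>carrier := N\<rparr>"
  have "reduce (m @ v) \<in> N \<longleftrightarrow> reduce v \<in> N" if m: "m \<in> N" for m v
  proof
    assume *: "reduce (m @ v) \<in> N"
    have "inv\<^bsub>free_group X\<^esub> m \<otimes>\<^bsub>free_group X\<^esub> reduce (m @ v) = reduce (inv\<^bsub>free_group X\<^esub> m @ m @ v)"
      by (simp add: free_group_mult reduce_append_right)
    also have "\<dots> = reduce (reduce (inv\<^bsub>free_group X\<^esub> m @ m) @ v)"
      by (simp add: reduce_append_left)
    also have "reduce (inv\<^bsub>free_group X\<^esub> m @ m) = []"
      using F.l_inv[OF N.mem_carrier[OF m]] by (simp add: free_group_mult)
    finally show "reduce v \<in> N"
      using N.m_closed[OF N.m_inv_closed[OF m] *] by simp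
  next
    assume "reduce v \<in> N"
    then show "reduce (m @ v) \<in> N"
      using N.m_closed[OF m] by (metis free_group_mult reduce_append_right)
  qed
  then have coset: "letter_flow N a m v = letter_flow N a [] v" if "m \<in> N" for m v
    using that by (intro letter_flow_cong) simp
  have "letter_flow N a [] \<in> hom ?N integer_group"
    by (rule homI) (auto simp: free_group_mult letter_flow_reduce letter_flow_append coset)
  then interpret group_hom ?N integer_group "letter_flow N a []"
    using F.subgroup_imp_group[OF assms(1)] by (simp add: group_hom_def group_hom_axioms_def)
  have "letter_flow N a [] ` derived ?N N = derived integer_group (letter_flow N a [] ` N)"
    using derived_img[of N] by simp
  also have "\<dots> = {0}"
    using comm_group.derived_eq_singleton[OF abelian_integer_group] by simp
  also have "derived ?N N = derived (free_group X) N"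
    by (rule F.derived_consistent) (simp_all add: assms)
  finally show ?thesis
    using assms(2) by blast
qed

lemma reduced_appendD:
  assumes "reduced (u @ v)" shows "reduced u" "reduced v"
  using assms by (auto simp: reduced_def successively_append_iff)

text \<open>Suppose that \<open>w\<close>, with first letter \<open>a\<close>, is a shortest nontrivial element of \<open>N\<close>. Then its
  closed path visits no vertex twice before it ends, since a proper nonempty subword that closes
  up would, by normality, be a shorter element of \<open>N\<close>. So the first edge is traversed just once,
  the flow along it is 1, and \<open>w\<close> cannot lie in the derived subgroup of \<open>N\<close>.\<close>
lemma derived_element_not_shortest:
  assumes "N \<lhd> free_group X" and w: "w \<in> derived (free_group X) N" "w \<noteq> []"
  shows "\<exists>v\<in>N. v \<noteq> [] \<and> length v < length w"
proof (rule ccontr)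
  interpret F: group "free_group X" by (rule group_free_group)
  interpret N: normal N "free_group X" by (rule assms(1))
  assume contr: "\<not> (\<exists>v\<in>N. v \<noteq> [] \<and> length v < length w)"
  have "w \<in> N"
    using F.derived_incl[OF order_refl N.subgroup_axioms] w(1) by blast
  then have "w \<in> carrier (free_group X)"
    using N.subset by blast
  then have red: "reduced w" and X: "fst ` set w \<subseteq> X"
    by (simp_all add: free_group_carrier)
  obtain a w' where aw: "w = a # w'"
    using w(2) by (cases w) auto
  \<comment> \<open>The later steps of the path do not use the first edge. Forwards they would need to start at
    the vertex \<open>N\<close>; backwards they would put \<open>a p a\<^sup>-\<^sup>1\<close> and hence \<open>p\<close> into \<open>N\<close>, where \<open>p\<close> is
    nonempty because \<open>w\<close> is reduced.\<close>
  have "letter_flow N a (a # p) q = 0" if "a # p @ q = w" for p q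
    using that
  proof (induction q arbitrary: p)
    case (Cons b q)
    have "reduced (a # p)"
      using red reduced_appendD(1)[of "a # p" "b # q"] Cons.prems by simp
    then have "reduce (a # p) \<notin> N"
      using contr Cons.prems[symmetric] by (auto simp: reduce_reduced)
    moreover have "reduce (a # p @ [b]) \<notin> N" if b: "b = inv_letter a"
    proof
      assume N: "reduce (a # p @ [b]) \<in> N"
      have "reduced (a # p @ [b])"
        using red reduced_appendD(1)[of "a # p @ [b]" q] Cons.prems by simp
      then have pN: "a # p @ [b] \<in> N" and "reduced p"
        using N reduced_appendD(1)[of p "[b]"] reduced_ConsD[of a "p @ [b]"] by (auto simp: reduce_reduced)
      have "p \<noteq> []"
        using \<open>reduced (a # p @ [b])\<close> b by (auto simp: reduced_def)
      have inv_a: "inv\<^bsub>free_group X\<^esub> [a] = [b]" and ac: "[a] \<in> carrier (free_group X)"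
      proof -
        show "[a] \<in> carrier (free_group X)"
          using X aw by (simp add: free_group_carrier reduced_def)
        moreover have "[b] \<in> carrier (free_group X)"
          using X aw b by (simp add: free_group_carrier reduced_def)
        moreover have "[b] \<otimes>\<^bsub>free_group X\<^esub> [a] = \<one>\<^bsub>free_group X\<^esub>"
          using b by (simp add: free_group_mult reduce_def)
        ultimately show "inv\<^bsub>free_group X\<^esub> [a] = [b]"
          by (intro F.inv_equality)
      qed
      have "[b] \<otimes>\<^bsub>free_group X\<^esub> (a # p @ [b]) \<otimes>\<^bsub>free_group X\<^esub> [a] = reduce (b # a # p @ [b, a])"
        by (simp add: free_group_mult reduce_append_left)
      also have "\<dots> = p"
        using reduce_cancel_pair[of "[]" b "p @ [b, a]"] reduce_cancel_pair[of p b "[]"] b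
          reduce_reduced[OF \<open>reduced p\<close>] by simp
      finally have "p \<in> N"
        using N.inv_op_closed1[OF ac pN] by (simp add: inv_a)
      moreover have "length p < length w"
        using Cons.prems[symmetric] by simp
      ultimately show False
        using contr \<open>p \<noteq> []\<close> by blast
    qed
    ultimately show ?case
      using Cons.IH[of "p @ [b]"] Cons.prems by auto
  qed simp
  from this[of "[]" w'] have "letter_flow N a [] w = 1"
    using N.one_closed by (simp add: aw reduce_def)
  then show False
    using letter_flow_derived[OF N.subgroup_axioms w(1)] by simp
qed

lemma length_less_of_derived_series:
  assumes "w \<in> (derived (free_group X) ^^ n) (carrier (free_group X))" "w \<noteq> []"
  shows "n < length w"
proof -
  interpret F: group "free_group X" by (rule group_free_group)
  have normal: "(derived (free_group X) ^^ n) (carrier (free_group X)) \<lhd> free_group X" for n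
    by (induction n) (simp_all add: F.normal_self F.derived_is_normal)
  show ?thesis
    using assms
  proof (induction n arbitrary: w)
    case (Suc n)
    then obtain v where "v \<in> (derived (free_group X) ^^ n) (carrier (free_group X))"
      "v \<noteq> []" "length v < length w"
      using derived_element_not_shortest[OF normal[of n], of w] by auto
    then show ?case
      using Suc.IH[of v] by simp
  qed simp
qed

section \<open>Free-by-cyclic groups are residually solvable\<close>

text \<open>The quotient by a term of the derived series is solvable, as its own derived series is the image
  of that of the group.\<close>
lemma (in group) residually_solvable_if_derived_series:
  assumes "\<And>g. g \<in> carrier G \<Longrightarrow> g \<noteq> \<one> \<Longrightarrow> \<exists>n. g \<notin> (derived G ^^ n) (carrier G)"
  shows "residually_solvable G"
  unfolding residually_solvable_def
proof (intro conjI ballI impI)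
  fix g assume g: "g \<in> carrier G" "g \<noteq> \<one>"
  then obtain n where n: "g \<notin> (derived G ^^ n) (carrier G)"
    using assms by blast
  let ?D = "(derived G ^^ n) (carrier G)"
  interpret D: normal ?D G
    by (induction n) (simp_all add: normal_self derived_is_normal)
  interpret Q: group "G Mod ?D"
    by (rule D.factorgroup_is_group)
  interpret group_hom G "G Mod ?D" "\<lambda>a. ?D #> a"
    using D.r_coset_hom_Mod by (simp add: group_hom_def group_hom_axioms_def Q.group_axioms)
  have "(derived (G Mod ?D) ^^ n) (carrier (G Mod ?D)) = (\<lambda>a. ?D #> a) ` ?D"
    using exp_of_derived_img[of "carrier G" n] by (simp add: carrier_FactGroup)
  also have "\<dots> = (\<lambda>a. ?D) ` ?D"
    by (rule image_cong) (simp_all add: D.rcos_const[OF group_axioms])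
  also have "\<dots> = {\<one>\<^bsub>G Mod ?D\<^esub>}"
    by (simp only: image_constant[OF D.one_closed] one_FactGroup)
  finally have "solvable (G Mod ?D)"
    using Q.solvable_iff_trivial_derived_seq by blast
  moreover have "(\<lambda>a. ?D #> a) \<in> epi G (G Mod ?D)"
    using D.r_coset_hom_Mod by (simp add: epi_def carrier_FactGroup)
  moreover have "?D #> g \<noteq> \<one>\<^bsub>G Mod ?D\<^esub>"
    using n rcos_self[OF g(1) D.subgroup_axioms] by auto
  ultimately show "\<exists>(S :: 'a set monoid) \<phi>. group S \<and> solvable S \<and> \<phi> \<in> epi G S \<and> \<phi> g \<noteq> \<one>\<^bsub>S\<^esub>"
    using Q.group_axioms by blast
qed (rule group_axioms)

text \<open>Up to the first step, the derived series of \<open>G\<close> lies in that of its free normal subgroup, where a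
  word of length \<open>n\<close> cannot survive \<open>n\<close> steps.\<close>
theorem free_by_cyclic_imp_residually_solvable:
  fixes G :: "('a, 'b) monoid_scheme"
  assumes "free_by_cyclic G"
  shows "residually_solvable G"
proof -
  obtain N where G: "group G" and N: "N \<lhd> G" and free: "is_free_group (G\<lparr>carrier := N\<rparr>)"
    and cyc: "cyclic_group (G Mod N)"
    using assms by (auto simp: free_by_cyclic_def)
  interpret group G by (rule G)
  interpret N: normal N G by (rule N)
  interpret Q: group "G Mod N" by (rule N.factorgroup_is_group)
  obtain X :: "'a set" and h where h: "h \<in> iso (free_group X) (G\<lparr>carrier := N\<rparr>)"
    using free by (auto simp: is_free_group_def is_iso_def)
  let ?F = "free_group X"
  have hom: "h \<in> hom ?F G" and img: "h ` carrier ?F = N" and inj: "inj_on h (carrier ?F)"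
    using h N.subset by (auto simp: iso_def hom_def bij_betw_def)
  interpret h: group_hom ?F G h
    using hom group_free_group G by (simp add: group_hom_def group_hom_axioms_def)
  have "derived G (carrier G) \<subseteq> N"
    using derived_minimal[OF N Q.cyclic_imp_abelian_group[OF cyc]] .
  then have sub: "(derived G ^^ Suc n) (carrier G) \<subseteq> h ` (derived ?F ^^ n) (carrier ?F)" for n
    using mono_exp_of_derived[of "derived G (carrier G)" N n] h.exp_of_derived_img[of "carrier ?F" n]
    by (simp add: funpow_swap1 img)
  show ?thesis
  proof (rule residually_solvable_if_derived_series, rule ccontr)
    fix g assume g: "g \<in> carrier G" "g \<noteq> \<one>\<^bsub>G\<^esub>"
      and "\<nexists>n. g \<notin> (derived G ^^ n) (carrier G)"
    then have all: "g \<in> h ` (derived ?F ^^ n) (carrier ?F)" for n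
      using sub[of n] by blast
    then obtain w where w: "w \<in> carrier ?F" "g = h w"
      by (metis funpow_0 imageE)
    have "w \<in> (derived ?F ^^ n) (carrier ?F)" for n
    proof -
      obtain v where v: "v \<in> (derived ?F ^^ n) (carrier ?F)" "g = h v"
        using all by blast
      then have "v \<in> carrier ?F"
        using h.G.exp_of_derived_in_carrier[of "carrier ?F" n] by auto
      then have "v = w"
        using inj w v(2) by (auto dest: inj_onD)
      then show ?thesis
        using v by simp
    qed
    moreover have "w \<noteq> []"
      using g(2) w(2) h.hom_one by auto
    ultimately show False
      using length_less_of_derived_series[of w "length w" X] by blast
  qed
qed

section \<open>Iterated commutators with a fixed element\<close>

lemma (in group_hom) hom_commutator:
  assumes "u \<in> carrier G" "v \<in> carrier G"
  shows "h (commutator G u v) = commutator H (h u) (h v)"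
  using assms by (simp add: commutator_def)

lemma (in group) commutator_closed:
  "u \<in> carrier G \<Longrightarrow> v \<in> carrier G \<Longrightarrow> commutator G u v \<in> carrier G"
  by (simp add: commutator_def)

lemma (in group) commutator_eqI:
  assumes "a \<in> carrier G" "b \<in> carrier G" "y \<in> carrier G" and "y \<otimes> (a \<otimes> b) = a \<otimes> y"
  shows "commutator G a y = b"
proof -
  have "commutator G a y = inv a \<otimes> (inv y \<otimes> (y \<otimes> (a \<otimes> b)))"
    using assms by (simp add: commutator_def m_assoc)
  also have "\<dots> = b"
    using assms(1-3) by (simp flip: m_assoc)
  finally show ?thesis .
qed

lemma (in group) conjugate_by_commutator:
  assumes "a \<in> carrier G" "y \<in> carrier G"
  shows "inv y \<otimes> a \<otimes> y = a \<otimes> commutator G a y"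
  using assms by (simp add: commutator_def flip: m_assoc)

lemma (in group) conjugate_mult:
  assumes "g \<in> carrier G" "a \<in> carrier G" "b \<in> carrier G"
  shows "g \<otimes> (a \<otimes> b) \<otimes> inv g = (g \<otimes> a \<otimes> inv g) \<otimes> (g \<otimes> b \<otimes> inv g)"
proof -
  have "inv g \<otimes> (g \<otimes> (b \<otimes> inv g)) = b \<otimes> inv g"
    using assms by (simp flip: m_assoc)
  then show ?thesis
    using assms by (simp add: m_assoc)
qed

lemma (in group) conjugate_inv:
  assumes "g \<in> carrier G" "a \<in> carrier G"
  shows "g \<otimes> inv a \<otimes> inv g = inv (g \<otimes> a \<otimes> inv g)"
  using assms by (simp add: inv_mult_group m_assoc)

text \<open>Normality may be tested on generators of both the group and the subgroup. Conjugation by the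
  inverses of the generators has to be tested too: an element may conjugate an infinite subgroup
  into a proper part of it.\<close>
lemma (in group) normal_generateI_generators:
  assumes A: "A \<subseteq> carrier G" "generate G A = carrier G" and S: "S \<subseteq> carrier G"
    and conj: "\<And>a s. a \<in> A \<Longrightarrow> s \<in> S \<Longrightarrow> a \<otimes> s \<otimes> inv a \<in> generate G S"
    and conj_inv: "\<And>a s. a \<in> A \<Longrightarrow> s \<in> S \<Longrightarrow> inv a \<otimes> s \<otimes> a \<in> generate G S"
  shows "generate G S \<lhd> G"
proof (rule normal_invI)
  interpret N: subgroup "generate G S" G
    using S by (rule generate_is_subgroup)
  have ext: "g \<otimes> n \<otimes> inv g \<in> generate G S"
    if g: "g \<in> carrier G" and gs: "\<And>s. s \<in> S \<Longrightarrow> g \<otimes> s \<otimes> inv g \<in> generate G S"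
      and n: "n \<in> generate G S" for g n
    using n
  proof (induction rule: generate.induct)
    case one
    then show ?case using g by simp
  next
    case (inv s)
    have "s \<in> carrier G"
      using S inv by blast
    then show ?case
      using conjugate_inv[OF g] N.m_inv_closed[OF gs[OF inv]] by simp
  next
    case (eng m n)
    then show ?case
      using conjugate_mult[OF g N.mem_carrier N.mem_carrier] N.m_closed by simp
  qed (rule gs)
  show "subgroup (generate G S) G"
    by (rule N.subgroup_axioms)
  fix g n assume "g \<in> carrier G" and n: "n \<in> generate G S"
  then have "g \<in> generate G A"
    using A by simp
  then show "g \<otimes> n \<otimes> inv g \<in> generate G S"
    using n
  proof (induction arbitrary: n rule: generate.induct)
    case (incl a)
    then have "a \<in> carrier G" and "\<And>s. s \<in> S \<Longrightarrow> a \<otimes> s \<otimes> inv a \<in> generate G S"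
      using A(1) conj by auto
    then show ?case
      using incl.prems by (rule ext)
  next
    case (inv a)
    then have "a \<in> carrier G"
      using A(1) by auto
    then have "inv a \<in> carrier G"
      and "\<And>s. s \<in> S \<Longrightarrow> inv a \<otimes> s \<otimes> inv (inv a) \<in> generate G S"
      using conj_inv[OF inv.hyps] by simp_all
    then show ?case
      using inv.prems by (rule ext)
  next
    case (eng a b)
    then have "a \<in> carrier G" "b \<in> carrier G" "n \<in> carrier G"
      using generate_in_carrier[OF A(1)] by (auto intro: N.mem_carrier)
    then have "a \<otimes> b \<otimes> n \<otimes> inv (a \<otimes> b) = a \<otimes> (b \<otimes> n \<otimes> inv b) \<otimes> inv a"
      by (simp add: inv_mult_group m_assoc)
    then show ?case
      using eng by simp
  qed simp
qed

text \<open>The towers below are indexed from 1 with successor \<open>m + 1\<close>, and rewriting 1 to \<open>Suc 0\<close>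
  would break the match with their recursion equations.\<close>
declare One_nat_def [simp del]

lemma (in group) commutator_tower_closed:
  fixes S :: "nat \<Rightarrow> 'a"
  assumes "S 1 \<in> carrier G" "y \<in> carrier G"
    and "\<And>m. m \<ge> 1 \<Longrightarrow> S (m + 1) = commutator G (S m) y" and "m \<ge> 1"
  shows "S m \<in> carrier G"
  using assms(4) by (induction m rule: dec_induct) (use assms(1-3) commutator_closed in \<open>auto simp: Suc_eq_plus1\<close>)

text \<open>The recursion says \<open>y\<^sup>-\<^sup>1 s\<^sub>m y = s\<^sub>m s\<^sub>m\<^sub>+\<^sub>1\<close>, so conjugation by \<open>y\<^sup>-\<^sup>1\<close> stays in the subgroup.
  Applying \<open>y\<close>-conjugation to this equation expresses \<open>y s\<^sub>m y\<^sup>-\<^sup>1\<close> by \<open>s\<^sub>m\<close> and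
  \<open>y s\<^sub>m\<^sub>+\<^sub>1 y\<^sup>-\<^sup>1\<close>, so the other direction follows by descending induction from the trivial
  \<open>s\<^sub>k\<^sub>+\<^sub>1\<close>.\<close>
lemma (in group) commutator_tower_normal_cyclic:
  fixes S :: "nat \<Rightarrow> 'a"
  assumes x: "S 1 \<in> carrier G" and y: "y \<in> carrier G" and gen: "generate G {S 1, y} = carrier G"
    and step: "\<And>m. m \<ge> 1 \<Longrightarrow> S (m + 1) = commutator G (S m) y"
    and k: "k \<ge> 1" and trivial: "S (k + 1) = \<one>"
  shows "generate G (S ` {1..k}) \<lhd> G" and "cyclic_group (G Mod generate G (S ` {1..k}))"
proof -
  let ?N = "generate G (S ` {1..k})"
  have S: "S m \<in> carrier G" if "m \<ge> 1" for m
    using commutator_tower_closed[OF x y step that] .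
  then have sub: "S ` {1..k} \<subseteq> carrier G"
    by auto
  interpret N: subgroup ?N G
    using sub by (rule generate_is_subgroup)
  have N: "S m \<in> ?N" if "1 \<le> m" "m \<le> k + 1" for m
  proof (cases "m = k + 1")
    case True
    then show ?thesis
      using trivial N.one_closed by (simp only:)
  next
    case False
    then show ?thesis
      using that by (intro generate.incl) auto
  qed
  have yN: "y \<otimes> S m \<otimes> inv y \<in> ?N" if "1 \<le> m" "m \<le> k + 1" for m
    using that(2,1)
  proof (induction rule: inc_induct)
    case base
    have "y \<otimes> S (k + 1) \<otimes> inv y = \<one>"
      using trivial y by simp
    then show ?case
      using N.one_closed by (simp only:)
  next
    case (step m)
    have "y \<otimes> (inv y \<otimes> S m) = S m"
      using S[OF step.prems] y by (simp flip: m_assoc)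
    moreover have "S m \<otimes> S (m + 1) = inv y \<otimes> S m \<otimes> y"
      using conjugate_by_commutator[OF S y] assms(4) step.prems by simp
    ultimately have "y \<otimes> (S m \<otimes> S (m + 1)) \<otimes> inv y = S m"
      using S[OF step.prems] y by (simp add: m_assoc)
    then have "S m = (y \<otimes> S m \<otimes> inv y) \<otimes> (y \<otimes> S (Suc m) \<otimes> inv y)"
      using conjugate_mult[of y "S m" "S (Suc m)"] S[of m] S[of "Suc m"] y step.prems
      by (simp add: Suc_eq_plus1)
    then have "y \<otimes> S m \<otimes> inv y = S m \<otimes> inv (y \<otimes> S (Suc m) \<otimes> inv y)"
      using S[of m] S[of "Suc m"] y step.prems by (intro inv_solve_right[THEN iffD2]) auto
    then show ?case
      using N.m_closed[OF N[of m] N.m_inv_closed[OF step.IH]] step by simp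
  qed
  show normal: "?N \<lhd> G"
  proof (rule normal_generateI_generators[OF _ gen sub])
    fix a s assume "a \<in> {S 1, y}" "s \<in> S ` {1..k}"
    then obtain m where m: "s = S m" "1 \<le> m" "m \<le> k"
      by auto
    have x_N: "S 1 \<in> ?N" and s_N: "S m \<in> ?N"
      using N[of 1] N[of m] m k by auto
    consider "a = S 1" | "a = y"
      using \<open>a \<in> {S 1, y}\<close> by blast
    then have "a \<otimes> s \<otimes> inv a \<in> ?N \<and> inv a \<otimes> s \<otimes> a \<in> ?N"
    proof cases
      case 1
      then show ?thesis
        using x_N s_N m(1) by simp
    next
      case 2
      have "inv y \<otimes> S m \<otimes> y = S m \<otimes> S (m + 1)"
        using conjugate_by_commutator[OF S[OF m(2)] y] assms(4)[OF m(2)] by simp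
      then show ?thesis
        using 2 yN[of m] N.m_closed[OF s_N N[of "m + 1"]] m by simp
    qed
    then show "a \<otimes> s \<otimes> inv a \<in> ?N" and "inv a \<otimes> s \<otimes> a \<in> ?N"
      by simp_all
  qed (use x y in auto)
  interpret NN: normal ?N G by (rule normal)
  interpret Q: group "G Mod ?N" by (rule NN.factorgroup_is_group)
  interpret \<pi>: group_hom G "G Mod ?N" "\<lambda>a. ?N #> a"
    using NN.r_coset_hom_Mod by (simp add: group_hom_def group_hom_axioms_def Q.group_axioms)
  have "?N #> S 1 = \<one>\<^bsub>G Mod ?N\<^esub>"
    using N.rcos_const[OF group_axioms N[of 1]] k by simp
  then have "carrier (G Mod ?N) = generate (G Mod ?N) {\<one>\<^bsub>G Mod ?N\<^esub>, ?N #> y}"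
    using \<pi>.generate_img[of "{S 1, y}"] x y gen by (simp add: carrier_FactGroup)
  also have "\<dots> \<subseteq> generate (G Mod ?N) {?N #> y}"
    using Q.generate_is_subgroup[of "{?N #> y}"] generate.one[of "G Mod ?N" "{?N #> y}"] y
    by (intro Q.generate_subgroup_incl) (auto intro: generate.incl)
  finally have "generate (G Mod ?N) {?N #> y} = carrier (G Mod ?N)"
    using Q.generate_incl[of "{?N #> y}"] y by auto
  then have "subgroup_generated (G Mod ?N) {?N #> y} = G Mod ?N"
    using y by (simp add: subgroup_generated_def Int_absorb1)
  then show "cyclic_group (G Mod ?N)"
    using Q.cyclic_group_alt by blast
qed

section \<open>A faithful permutation model\<close>

definition left_translation :: "('a, 'b) monoid_scheme \<Rightarrow> 'a \<Rightarrow> 'a \<Rightarrow> 'a" where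
  "left_translation G g = (\<lambda>w \<in> carrier G. g \<otimes>\<^bsub>G\<^esub> w)"

lemma (in group) left_translation_Bij:
  assumes "g \<in> carrier G"
  shows "left_translation G g \<in> Bij (carrier G)"
proof -
  have "bij_betw (\<lambda>w. g \<otimes> w) (carrier G) (carrier G)"
    by (rule bij_betwI[where g = "\<lambda>w. inv g \<otimes> w"]) (use assms in \<open>auto simp flip: m_assoc\<close>)
  then show ?thesis
    by (simp add: Bij_def left_translation_def bij_betw_restrict_eq)
qed

lemma (in group) left_translation_hom:
  "left_translation G \<in> hom G (BijGroup (carrier G))"
proof (rule homI)
  fix g h assume "g \<in> carrier G" "h \<in> carrier G"
  then show "left_translation G (g \<otimes> h) =
      left_translation G g \<otimes>\<^bsub>BijGroup (carrier G)\<^esub> left_translation G h"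
    using left_translation_Bij[of g] left_translation_Bij[of h]
    by (auto simp: BijGroup_def compose_def left_translation_def m_assoc intro!: restrict_ext)
qed (simp add: BijGroup_def left_translation_Bij)

lemma (in group) left_translation_inj: "inj_on (left_translation G) (carrier G)"
proof (rule inj_onI)
  fix g h assume gh: "g \<in> carrier G" "h \<in> carrier G" and "left_translation G g = left_translation G h"
  then have "left_translation G g \<one> = left_translation G h \<one>"
    by simp
  then show "g = h"
    using gh by (simp add: left_translation_def)
qed

text \<open>This is \<open>\<psi>(g w) = \<psi>(g) \<psi>(w)\<close>, read as an identity between permutations of \<open>G\<close>.\<close>
lemma (in group) left_translation_endomorphism:
  assumes "\<psi> \<in> hom G G" "bij_betw \<psi> (carrier G) (carrier G)" "g \<in> carrier G"
  shows "restrict \<psi> (carrier G) \<otimes>\<^bsub>BijGroup (carrier G)\<^esub> left_translation G g =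
    left_translation G (\<psi> g) \<otimes>\<^bsub>BijGroup (carrier G)\<^esub> restrict \<psi> (carrier G)"
proof -
  have "restrict \<psi> (carrier G) \<in> Bij (carrier G)"
    using assms(2) by (simp add: Bij_def bij_betw_restrict_eq)
  moreover have "\<psi> g \<in> carrier G"
    using assms(1,3) by (auto simp: hom_def)
  ultimately show ?thesis
    using assms(1,3) left_translation_Bij
    by (auto simp: BijGroup_def compose_def left_translation_def hom_def Pi_iff intro!: restrict_ext)
qed

text \<open>Continuing the free generators \<open>t\<^sub>1, \<dots>, t\<^sub>k\<close> by trivial elements lets the last generator, which
  commutes with \<open>y\<close>, obey the same formulas as the others.\<close>
definition tower_gen :: "nat \<Rightarrow> nat \<Rightarrow> nat fg_word" where
  "tower_gen k m = (if m \<le> k then fg_gen m else [])"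

text \<open>With \<open>q\<^sub>m = inverse_tower k (k + 1 - m)\<close> this is the solution of \<open>q\<^sub>m q\<^sub>m\<^sub>+\<^sub>1 = t\<^sub>m\<close> with
  \<open>q\<^sub>k\<^sub>+\<^sub>1 = 1\<close>, computed from the top down; these are the images of the generators under the inverse
  of \<open>t\<^sub>m \<mapsto> t\<^sub>m t\<^sub>m\<^sub>+\<^sub>1\<close>.\<close>
primrec inverse_tower :: "nat \<Rightarrow> nat \<Rightarrow> nat fg_word" where
  "inverse_tower k 0 = []"
| "inverse_tower k (Suc j) =
     tower_gen k (k - j) \<otimes>\<^bsub>free_group {1..k}\<^esub> inv\<^bsub>free_group {1..k}\<^esub> inverse_tower k j"

lemma tower_gen_closed: "m \<ge> 1 \<Longrightarrow> tower_gen k m \<in> carrier (free_group {1..k})"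
  using group.is_monoid[OF group_free_group, THEN monoid.one_closed, of "{1..k}"]
  by (auto simp: tower_gen_def intro: fg_gen_in_carrier)

text \<open>The two endomorphisms \<open>\<psi>: t\<^sub>m \<mapsto> q\<^sub>m\<close> and \<open>\<phi>: t\<^sub>m \<mapsto> t\<^sub>m t\<^sub>m\<^sub>+\<^sub>1\<close> are mutually inverse: \<open>\<psi> \<phi>\<close> fixes
  the generators because \<open>q\<^sub>m q\<^sub>m\<^sub>+\<^sub>1 = t\<^sub>m\<close>, and \<open>\<phi> \<psi>\<close> fixes them by descending induction on \<open>m\<close>.\<close>
lemma tower_automorphism:
  obtains \<psi> where "\<psi> \<in> hom (free_group {1..k}) (free_group {1..k})"
    "bij_betw \<psi> (carrier (free_group {1..k})) (carrier (free_group {1..k}))"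
    "\<And>m. m \<ge> 1 \<Longrightarrow>
      \<psi> (tower_gen k m \<otimes>\<^bsub>free_group {1..k}\<^esub> tower_gen k (m + 1)) = tower_gen k m"
proof -
  let ?F = "free_group {1..k}"
  interpret F: group ?F by (rule group_free_group)
  define q where "q m = inverse_tower k (Suc k - m)" for m
  have q_step: "q m = tower_gen k m \<otimes>\<^bsub>?F\<^esub> inv\<^bsub>?F\<^esub> q (m + 1)" if "m \<le> k" for m
    using that by (simp add: q_def Suc_diff_le)
  have q_trivial: "q m = \<one>\<^bsub>?F\<^esub>" if "m > k" for m
    using that by (simp add: q_def)
  have "inverse_tower k j \<in> carrier ?F" if "j \<le> k" for j
    using that by (induction j) (use F.one_closed in \<open>auto intro!: F.m_closed F.inv_closed tower_gen_closed\<close>)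
  then have q_closed: "q m \<in> carrier ?F" if "m \<ge> 1" for m
    using that by (simp add: q_def)
  have q_fun: "q \<in> {1..k} \<rightarrow> carrier ?F"
    and p_fun: "(\<lambda>m. tower_gen k m \<otimes>\<^bsub>?F\<^esub> tower_gen k (m + 1)) \<in> {1..k} \<rightarrow> carrier ?F"
    by (auto intro!: q_closed F.m_closed tower_gen_closed)
  define \<psi> where "\<psi> = free_lift ?F q"
  define \<phi> where "\<phi> = free_lift ?F (\<lambda>m. tower_gen k m \<otimes>\<^bsub>?F\<^esub> tower_gen k (m + 1))"
  interpret \<psi>: group_hom ?F ?F \<psi>
    unfolding \<psi>_def using F.free_lift_hom[OF q_fun]
    by (simp add: group_hom_def group_hom_axioms_def F.group_axioms)
  interpret \<phi>: group_hom ?F ?F \<phi>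
    unfolding \<phi>_def using F.free_lift_hom[OF p_fun]
    by (simp add: group_hom_def group_hom_axioms_def F.group_axioms)
  have \<psi>_gen: "\<psi> (tower_gen k m) = q m" if "m \<ge> 1" for m
  proof (cases "m \<le> k")
    case True
    then show ?thesis
      using that F.free_lift_gen[OF q_fun, of m] by (simp add: \<psi>_def tower_gen_def)
  next
    case False
    then show ?thesis
      using \<psi>.hom_one q_trivial[of m] by (simp add: tower_gen_def)
  qed
  have \<phi>_gen: "\<phi> (fg_gen m) = tower_gen k m \<otimes>\<^bsub>?F\<^esub> tower_gen k (m + 1)" if "m \<in> {1..k}" for m
    using F.free_lift_gen[OF p_fun that] by (simp add: \<phi>_def)
  have \<psi>_step: "\<psi> (tower_gen k m \<otimes>\<^bsub>?F\<^esub> tower_gen k (m + 1)) = tower_gen k m" if "m \<ge> 1" for m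
  proof (cases "m \<le> k")
    case True
    have "\<psi> (tower_gen k m \<otimes>\<^bsub>?F\<^esub> tower_gen k (m + 1)) = q m \<otimes>\<^bsub>?F\<^esub> q (m + 1)"
      using that tower_gen_closed[of m k] tower_gen_closed[of "m + 1" k] by (simp add: \<psi>_gen)
    also have "\<dots> = tower_gen k m"
      using q_step[OF True] q_closed[of "m + 1"] tower_gen_closed[OF that, of k]
      by (simp add: F.m_assoc del: free_group_one)
    finally show ?thesis .
  next
    case False
    then show ?thesis
      using \<psi>.hom_one F.l_one[OF F.one_closed] by (simp add: tower_gen_def)
  qed
  have \<phi>_q: "\<phi> (q m) = tower_gen k m" if "m \<le> k + 1" "m \<ge> 1" for m
    using that
  proof (induction rule: inc_induct)
    case base
    then show ?case
      using q_trivial[of "k + 1"] \<phi>.hom_one by (simp add: tower_gen_def)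
  next
    case (step m)
    have m: "m \<in> {1..k}"
      using step by simp
    have closed: "tower_gen k m \<in> carrier ?F" "tower_gen k (m + 1) \<in> carrier ?F" "q (m + 1) \<in> carrier ?F"
      using step by (auto intro: tower_gen_closed q_closed)
    have "\<phi> (q m) = \<phi> (tower_gen k m) \<otimes>\<^bsub>?F\<^esub> inv\<^bsub>?F\<^esub> \<phi> (q (m + 1))"
      using q_step[of m] m closed by simp
    also have "\<dots> = tower_gen k m \<otimes>\<^bsub>?F\<^esub> tower_gen k (m + 1) \<otimes>\<^bsub>?F\<^esub> inv\<^bsub>?F\<^esub> tower_gen k (m + 1)"
      using \<phi>_gen[OF m] step.IH m by (simp add: tower_gen_def Suc_eq_plus1)
    also have "\<dots> = tower_gen k m"
      using closed by (simp add: F.m_assoc del: free_group_one)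
    finally show ?case .
  qed
  have "\<psi> (\<phi> w) = w" if "w \<in> carrier ?F" for w
  proof (rule free_group_endo_id[of "\<lambda>w. \<psi> (\<phi> w)", OF _ _ that])
    show "(\<lambda>w. \<psi> (\<phi> w)) \<in> hom ?F ?F"
      using hom_compose[OF \<phi>.homh \<psi>.homh] by (simp add: o_def)
    show "\<psi> (\<phi> (fg_gen m)) = fg_gen m" if "m \<in> {1..k}" for m
      using that \<psi>_step[of m] by (simp add: \<phi>_gen) (simp add: tower_gen_def)
  qed
  moreover have "\<phi> (\<psi> w) = w" if "w \<in> carrier ?F" for w
  proof (rule free_group_endo_id[of "\<lambda>w. \<phi> (\<psi> w)", OF _ _ that])
    show "(\<lambda>w. \<phi> (\<psi> w)) \<in> hom ?F ?F"
      using hom_compose[OF \<psi>.homh \<phi>.homh] by (simp add: o_def)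
    show "\<phi> (\<psi> (fg_gen m)) = fg_gen m" if "m \<in> {1..k}" for m
      using that \<psi>_gen[of m] \<phi>_q[of m] by (simp add: tower_gen_def)
  qed
  ultimately have "bij_betw \<psi> (carrier ?F) (carrier ?F)"
    by (intro bij_betwI[where g = \<phi>]) auto
  with \<psi>.homh \<psi>_step show thesis
    using that by blast
qed

text \<open>Let \<open>x\<close> act as left translation by \<open>t\<^sub>1\<close> and \<open>y\<close> as \<open>\<psi>\<close>. Applying \<open>\<psi>\<close> after translation
  by \<open>t\<^sub>m t\<^sub>m\<^sub>+\<^sub>1\<close> is the same as translation by \<open>t\<^sub>m\<close> after \<open>\<psi>\<close>, which says that the commutator of
  translation by \<open>t\<^sub>m\<close> with \<open>\<psi>\<close> is translation by \<open>t\<^sub>m\<^sub>+\<^sub>1\<close>.\<close>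
lemma tower_model:
  fixes x y :: 'a and s :: "nat \<Rightarrow> 'a fg_word"
  assumes "x \<noteq> y" and k: "k \<ge> 1" and s1: "s 1 = fg_gen x"
    and s_step: "\<And>m. m \<ge> 1 \<Longrightarrow> s (m + 1) = commutator (free_group {x, y}) (s m) (fg_gen y)"
  obtains \<Lambda> where
    "\<Lambda> \<in> hom (free_group {x, y}) (BijGroup (carrier (free_group {1..k})))"
    "\<And>m. m \<ge> 1 \<Longrightarrow> \<Lambda> (s m) = left_translation (free_group {1..k}) (tower_gen k m)"
proof -
  let ?F = "free_group {1..k}" and ?E = "free_group {x, y}"
  let ?B = "BijGroup (carrier ?F)" and ?L = "left_translation ?F"
  interpret F: group ?F by (rule group_free_group)
  interpret E: group ?E by (rule group_free_group)
  interpret B: group ?B by (rule group_BijGroup)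
  interpret L: group_hom ?F ?B ?L
    using F.left_translation_hom by (simp add: group_hom_def group_hom_axioms_def F.group_axioms B.group_axioms)
  obtain \<psi> where \<psi>: "\<psi> \<in> hom ?F ?F" "bij_betw \<psi> (carrier ?F) (carrier ?F)"
    and \<psi>_step: "\<And>m. m \<ge> 1 \<Longrightarrow> \<psi> (tower_gen k m \<otimes>\<^bsub>?F\<^esub> tower_gen k (m + 1)) = tower_gen k m"
    using tower_automorphism by blast
  let ?\<psi> = "restrict \<psi> (carrier ?F)"
  have \<psi>_closed: "?\<psi> \<in> carrier ?B"
    using \<psi>(2) by (simp add: BijGroup_def Bij_def)
  define f where "f z = (if z = x then ?L (tower_gen k 1) else ?\<psi>)" for z
  have f: "f \<in> {x, y} \<rightarrow> carrier ?B"
    using \<psi>_closed tower_gen_closed[of 1 k] by (auto simp: f_def)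
  interpret \<Lambda>: group_hom ?E ?B "free_lift ?B f"
    using B.free_lift_hom[OF f] by (simp add: group_hom_def group_hom_axioms_def E.group_axioms B.group_axioms)
  have y: "free_lift ?B f (fg_gen y) = ?\<psi>" "fg_gen y \<in> carrier ?E"
    using B.free_lift_gen[OF f, of y] \<open>x \<noteq> y\<close> by (auto simp: f_def intro: fg_gen_in_carrier)
  have s_closed: "s m \<in> carrier ?E" if "m \<ge> 1" for m
    using E.commutator_tower_closed[where S = s, OF _ y(2) s_step that] s1 by (simp add: fg_gen_in_carrier)
  have "free_lift ?B f (s m) = ?L (tower_gen k m)" if "m \<ge> 1" for m
    using that
  proof (induction m rule: dec_induct)
    case base
    have "f x = ?L (tower_gen k 1)"
      by (simp add: f_def)
    then show ?case
      using B.free_lift_gen[OF f, of x] s1 by simp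
  next
    case (step m)
    have t: "tower_gen k m \<in> carrier ?F" "tower_gen k (m + 1) \<in> carrier ?F"
      using step.hyps by (auto intro: tower_gen_closed)
    have "free_lift ?B f (s (m + 1)) = commutator ?B (?L (tower_gen k m)) ?\<psi>"
      using s_step[OF step.hyps(1)] s_closed[OF step.hyps(1)] y step.IH by (simp add: \<Lambda>.hom_commutator)
    also have "\<dots> = ?L (tower_gen k (m + 1))"
      using F.left_translation_endomorphism[OF \<psi> F.m_closed[OF t]] \<psi>_step[OF step.hyps(1)] t \<psi>_closed
      by (intro B.commutator_eqI) simp_all
    finally show ?case
      by (simp add: Suc_eq_plus1)
  qed
  then show thesis
    using that \<Lambda>.homh by blast
qed

section \<open>The one-relator group\<close>

theorem theorem5p2:
  fixes x y :: 'a and k :: nat and s :: "nat \<Rightarrow> 'a fg_word"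
  assumes "x \<noteq> y" and "k \<ge> 1"
    and "s 1 = fg_gen x"
    and "\<And>m. m \<ge> 1 \<Longrightarrow> s (m + 1) = commutator (free_group {x, y}) (s m) (fg_gen y)"
  defines "r \<equiv> commutator (free_group {x, y}) (s k) (fg_gen y)"
  defines "G \<equiv> presented_group {x, y} {r}"
  shows "free_by_cyclic G \<and> residually_solvable G"
proof -
  let ?E = "free_group {x, y}" and ?F = "free_group {1..k}"
  let ?R = "normal_closure ?E {r}" and ?L = "left_translation ?F"
  let ?B = "BijGroup (carrier ?F)"
  interpret E: group ?E by (rule group_free_group)
  interpret F: group ?F by (rule group_free_group)
  interpret B: group ?B by (rule group_BijGroup)
  have xy: "fg_gen x \<in> carrier ?E" "fg_gen y \<in> carrier ?E"
    by (simp_all add: fg_gen_in_carrier)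
  have s_closed: "s m \<in> carrier ?E" if "m \<ge> 1" for m
    using E.commutator_tower_closed[where S = s, OF _ xy(2) assms(4) that] assms(3) xy by simp
  have r: "r = s (k + 1)"
    using assms(2,4) by (simp add: r_def)
  then have "{r} \<subseteq> carrier ?E"
    using s_closed[of "k + 1"] by simp
  then interpret R: normal ?R ?E
    by (rule E.normal_normal_closure)
  interpret G: group G
    unfolding G_def using \<open>{r} \<subseteq> carrier ?E\<close> by (rule group_presented_group)
  have G: "G = ?E Mod ?R"
    by (simp add: G_def presented_group_def)
  define \<pi> where "\<pi> w = ?R #>\<^bsub>?E\<^esub> w" for w
  interpret \<pi>: group_hom ?E G \<pi>
    using R.r_coset_hom_Mod by (simp add: group_hom_def group_hom_axioms_def G \<pi>_def[abs_def]
        E.group_axioms G.group_axioms[unfolded G])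
  have \<pi>_surj: "\<pi> ` carrier ?E = carrier G"
    by (simp add: G carrier_FactGroup \<pi>_def)
  define S where "S m = \<pi> (s m)" for m
  have "r \<in> ?R"
    by (auto simp: normal_closure_def)
  then have S_trivial: "S (k + 1) = \<one>\<^bsub>G\<^esub>"
    using R.rcos_const[OF E.group_axioms] by (simp add: S_def \<pi>_def G flip: r)
  have S_step: "S (m + 1) = commutator G (S m) (\<pi> (fg_gen y))" if "m \<ge> 1" for m
    using that xy s_closed by (simp add: S_def assms(4) \<pi>.hom_commutator)
  have S_closed: "S m \<in> carrier G" if "m \<ge> 1" for m
    using s_closed[OF that] by (simp add: S_def)
  have gen: "generate G {S 1, \<pi> (fg_gen y)} = carrier G"
    using \<pi>.generate_img[of "fg_gen ` {x, y}"] xy \<pi>_surj free_group_generated[of "{x, y}"] assms(3)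
    by (simp add: S_def)
  define \<theta> where "\<theta> = free_lift G S"
  have S_fun: "S \<in> {1..k} \<rightarrow> carrier G"
    using S_closed by auto
  interpret \<theta>: group_hom ?F G \<theta>
    unfolding \<theta>_def using G.free_lift_hom[OF S_fun]
    by (simp add: group_hom_def group_hom_axioms_def F.group_axioms G.group_axioms)
  have \<theta>_gen: "\<theta> (fg_gen m) = S m" if "m \<in> {1..k}" for m
    using G.free_lift_gen[OF S_fun that] by (simp add: \<theta>_def)
  obtain \<Lambda> where \<Lambda>: "\<Lambda> \<in> hom ?E ?B" and \<Lambda>_s: "\<And>m. m \<ge> 1 \<Longrightarrow> \<Lambda> (s m) = ?L (tower_gen k m)"
    using tower_model[OF assms(1-4)] by blast
  interpret \<Lambda>: group_hom ?E ?B \<Lambda>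
    using \<Lambda> by (simp add: group_hom_def group_hom_axioms_def E.group_axioms B.group_axioms)
  interpret L: group_hom ?F ?B ?L
    using F.left_translation_hom by (simp add: group_hom_def group_hom_axioms_def F.group_axioms B.group_axioms)
  have "\<Lambda> r = \<one>\<^bsub>?B\<^esub>"
    using \<Lambda>_s[of "k + 1"] L.hom_one by (simp add: r tower_gen_def)
  then have "?R \<subseteq> kernel ?E ?B \<Lambda>"
    using \<Lambda>.normal_kernel \<open>{r} \<subseteq> carrier ?E\<close> by (auto simp: normal_closure_def kernel_def)
  then obtain \<Lambda>' where \<Lambda>': "\<Lambda>' \<in> hom G ?B" "\<And>w. w \<in> carrier ?E \<Longrightarrow> \<Lambda>' (\<pi> w) = \<Lambda> w"
    using \<Lambda>.FactGroup_universal_kernel[OF R.normal_axioms] unfolding G \<pi>_def by metis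
  have \<Lambda>'\<theta>: "\<Lambda>' (\<theta> w) = ?L w" if "w \<in> carrier ?F" for w
  proof (rule free_group_hom_eq[OF B.group_axioms _ L.homh _ that])
    show "(\<lambda>w. \<Lambda>' (\<theta> w)) \<in> hom ?F ?B"
      using hom_compose[OF \<theta>.homh \<Lambda>'(1)] by (simp add: o_def)
    show "\<Lambda>' (\<theta> (fg_gen m)) = ?L (fg_gen m)" if "m \<in> {1..k}" for m
      using that \<Lambda>'(2)[OF s_closed[of m]] \<Lambda>_s[of m] by (simp add: \<theta>_gen S_def tower_gen_def)
  qed
  \<comment> \<open>Followed by the action on \<open>F\<close>, the map \<open>\<theta>\<close> becomes the regular representation, which is
    faithful.\<close>
  have "inj_on \<theta> (carrier ?F)"
    using F.left_translation_inj \<Lambda>'\<theta> by (metis inj_on_def)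
  then have free: "is_free_group (G\<lparr>carrier := \<theta> ` carrier ?F\<rparr>)"
    by (rule is_free_group_hom_image[OF G.group_axioms \<theta>.homh])
  have "\<theta> ` carrier ?F = generate G (\<theta> ` fg_gen ` {1..k})"
    using \<theta>.generate_img[of "fg_gen ` {1..k}"]
    by (simp add: free_group_generated image_subset_iff fg_gen_in_carrier)
  also have "\<theta> ` fg_gen ` {1..k} = S ` {1..k}"
    using \<theta>_gen by (simp add: image_image)
  finally have N: "\<theta> ` carrier ?F = generate G (S ` {1..k})" .
  have "free_by_cyclic G"
    unfolding free_by_cyclic_def
    using free G.group_axioms
      G.commutator_tower_normal_cyclic[OF S_closed[OF order_refl] \<pi>.hom_closed[OF xy(2)] gen S_step assms(2) S_trivial]
    unfolding N by blast
  then show ?thesis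
    using free_by_cyclic_imp_residually_solvable by blast
qed

end
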